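(* Let $G$ be a finite simple undirected graph with $n$ vertices and $m$ edges, and let $D[G]$ be its double graph. Let $p,k$ be integers with $k\ge 4$, $p\ge 2n+k$ and $m\le\frac{k(2n+k)}{8}$. Then $$LE(D[G]\vee\overline{K_p})=4n+(p-2n)\frac{2m'}{n'}+8m,$$ where $\frac{2m'}{n'}=\frac{8m+4pn}{p+2n}$ is the average vertex degree of $D[G]\vee\overline{K_p}$.
   Context: The Laplacian energy of a graph $H$ with $N$ vertices, $M$ edges and Laplacian eigenvalues $\nu_1,\dots,\nu_N$ (eigenvalues of $D-A$, with $A$ the adjacency matrix and $D$ the diagonal degree matrix) is $LE(H)=\sum_{i=1}^N|\nu_i-\frac{2M}{N}|$. The double graph $D[G]$ is obtained by taking two copies of $G$ and joining each vertex in one copy with the neighbours of the corresponding vertex in the other copy; i.e. it has vertex set $V(G)\times\{1,2\}$ with $(u,a)$ adjacent to $(v,b)$ iff $u$ is adjacent to $v$ in $G$. The join $H_1\vee H_2$ is the disjoint union of $H_1$ and $H_2$ together with all edges between $V(H_1)$ and $V(H_2)$. $\overline{K_p}$ is the edgeless graph on $p$ vertices. *)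

theory Defs
  imports
    "Graph_Theory.Pair_Digraph"
    "Jordan_Normal_Form.Char_Poly"
    "HOL-Library.Countable_Set"
begin

text \<open>
  A finite simple undirected graph is a \<^locale>\<open>pair_graph\<close>: a finite vertex set together with a
  symmetric irreflexive set of arcs. Both arcs \<open>(u, v)\<close> and \<open>(v, u)\<close> represent the single
  undirected edge \<open>{u, v}\<close>, so edges are counted as unordered pairs.
\<close>

definition edge_set :: "'a pair_pre_digraph \<Rightarrow> 'a set set" where
  "edge_set G = (\<lambda>(u, v). {u, v}) ` parcs G"

definition num_verts :: "'a pair_pre_digraph \<Rightarrow> nat" where
  "num_verts G = card (pverts G)"

definition num_edges :: "'a pair_pre_digraph \<Rightarrow> nat" where
  "num_edges G = card (edge_set G)"

text \<open>The arc set is symmetric, so the out-degree is the number of neighbours.\<close>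

definition vertex_degree :: "'a pair_pre_digraph \<Rightarrow> 'a \<Rightarrow> nat" where
  "vertex_degree G v = out_degree (with_proj G) v"

definition average_degree :: "'a pair_pre_digraph \<Rightarrow> real" where
  "average_degree G = (\<Sum>v\<in>pverts G. real (vertex_degree G v)) / real (num_verts G)"

text \<open>
  The matrices are indexed by natural numbers, so the vertices are enumerated by \<open>f\<close>. Below, \<open>f\<close> is
  the library's enumeration \<^const>\<open>from_nat_into\<close> of the vertex set, which on a finite set \<open>S\<close> is a
  bijection from \<open>{..<card S}\<close> to \<open>S\<close>. The characteristic polynomial does not depend on the choice
  (lemma \<open>char_poly_laplacian_matrix_of\<close>).
\<close>

definition adjacency_matrix_of :: "(nat \<Rightarrow> 'a) \<Rightarrow> 'a pair_pre_digraph \<Rightarrow> real mat" where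
  "adjacency_matrix_of f G =
     mat (num_verts G) (num_verts G) (\<lambda>(i, j). if (f i, f j) \<in> parcs G then 1 else 0)"

definition degree_matrix_of :: "(nat \<Rightarrow> 'a) \<Rightarrow> 'a pair_pre_digraph \<Rightarrow> real mat" where
  "degree_matrix_of f G =
     mat (num_verts G) (num_verts G) (\<lambda>(i, j). if i = j then real (vertex_degree G (f i)) else 0)"

definition laplacian_matrix_of :: "(nat \<Rightarrow> 'a) \<Rightarrow> 'a pair_pre_digraph \<Rightarrow> real mat" where
  "laplacian_matrix_of f G = degree_matrix_of f G - adjacency_matrix_of f G"

definition laplacian_matrix :: "'a pair_pre_digraph \<Rightarrow> real mat" where
  "laplacian_matrix G = laplacian_matrix_of (from_nat_into (pverts G)) G"

text \<open>
  The eigenvalues \<open>\<nu>\<^sub>1, \<dots>, \<nu>\<^sub>N\<close> with multiplicity, as roots of the characteristic polynomial. The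
  Laplacian matrix is real symmetric, so the real roots are all the eigenvalues.
\<close>

definition laplacian_eigenvalues :: "'a pair_pre_digraph \<Rightarrow> real multiset" where
  "laplacian_eigenvalues G = proots (char_poly (laplacian_matrix G))"

definition laplacian_energy :: "'a pair_pre_digraph \<Rightarrow> real" where
  "laplacian_energy G =
     (\<Sum>\<nu>\<in>#laplacian_eigenvalues G. \<bar>\<nu> - 2 * real (num_edges G) / real (num_verts G)\<bar>)"

definition double_graph :: "'a pair_pre_digraph \<Rightarrow> ('a \<times> nat) pair_pre_digraph" where
  "double_graph G =
     \<lparr> pverts = pverts G \<times> {1, 2},
       parcs = {((u, a), (v, b)) | u a v b. (u, v) \<in> parcs G \<and> a \<in> {1, 2} \<and> b \<in> {1, 2}} \<rparr>"

text \<open>The sum type makes the union of the two vertex sets disjoint.\<close>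

definition graph_join ::
    "'a pair_pre_digraph \<Rightarrow> 'b pair_pre_digraph \<Rightarrow> ('a + 'b) pair_pre_digraph" where
  "graph_join G H =
     \<lparr> pverts = Inl ` pverts G \<union> Inr ` pverts H,
       parcs = {(Inl u, Inl v) | u v. (u, v) \<in> parcs G}
             \<union> {(Inr u, Inr v) | u v. (u, v) \<in> parcs H}
             \<union> {(Inl u, Inr v) | u v. u \<in> pverts G \<and> v \<in> pverts H}
             \<union> {(Inr v, Inl u) | u v. u \<in> pverts G \<and> v \<in> pverts H} \<rparr>"

definition edgeless_graph :: "nat \<Rightarrow> nat pair_pre_digraph" where
  "edgeless_graph p = \<lparr> pverts = {..<p}, parcs = {} \<rparr>"

lemma pair_graphI:
  assumes "finite (pverts G)"
    and "\<And>u v. (u, v) \<in> parcs G \<Longrightarrow> u \<in> pverts G \<and> v \<in> pverts G \<and> u \<noteq> v \<and> (v, u) \<in> parcs G"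
  shows "pair_graph G"
proof -
  have "parcs G \<subseteq> pverts G \<times> pverts G" using assms(2) by auto
  then have "finite (parcs G)" using assms(1) finite_subset by blast
  then show ?thesis
    by unfold_locales (use assms in \<open>auto simp: symmetric_def intro!: symI\<close>)
qed

lemma pair_graphD:
  assumes "pair_graph G"
  shows "finite (pverts G)"
    and "(u, v) \<in> parcs G \<Longrightarrow> u \<in> pverts G \<and> v \<in> pverts G \<and> u \<noteq> v \<and> (v, u) \<in> parcs G"
proof -
  interpret pair_graph G by fact
  show "finite (pverts G)" by (rule pair_finite_verts)
  show "(u, v) \<in> parcs G \<Longrightarrow> u \<in> pverts G \<and> v \<in> pverts G \<and> u \<noteq> v \<and> (v, u) \<in> parcs G"
    using pair_sym_arcs in_arcsD1 in_arcsD2 pair_no_loops[of "(u, v)"]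
    by (auto simp: symmetric_def dest: symD)
qed

lemma pair_graph_edgeless_graph: "pair_graph (edgeless_graph p)"
  by (rule pair_graphI) (auto simp: edgeless_graph_def)

lemma pair_graph_double_graph: "pair_graph G \<Longrightarrow> pair_graph (double_graph G)"
  by (rule pair_graphI) (auto simp: double_graph_def dest: pair_graphD)

lemma pair_graph_graph_join: "pair_graph G \<Longrightarrow> pair_graph H \<Longrightarrow> pair_graph (graph_join G H)"
  by (rule pair_graphI) (auto simp: graph_join_def dest: pair_graphD)

lemma char_poly_reindex:
  fixes A :: "'a :: field mat"
  assumes A: "A \<in> carrier_mat n n" and bij: "bij_betw \<pi> {..<n} {..<n}"
  shows "char_poly (mat n n (\<lambda>(i, j). A $$ (\<pi> i, \<pi> j))) = char_poly A"
proof -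
  let ?B = "mat n n (\<lambda>(i, j). A $$ (\<pi> i, \<pi> j))"
  let ?P = "mat n n (\<lambda>(i, j). if \<pi> i = j then 1 else 0 :: 'a)"
  let ?Q = "mat n n (\<lambda>(i, j). if i = \<pi> j then 1 else 0 :: 'a)"
  have mem: "\<And>i. i < n \<Longrightarrow> \<pi> i < n" using bij by (auto simp: bij_betw_def)
  have inj: "\<And>i j. i < n \<Longrightarrow> j < n \<Longrightarrow> \<pi> i = \<pi> j \<longleftrightarrow> i = j"
    using bij by (auto simp: bij_betw_def inj_on_def)
  have PQ: "?P * ?Q = 1\<^sub>m n"
    by (rule eq_matI) (auto simp: scalar_prod_def mem inj if_distrib[of "\<lambda>x. x * _"] cong: if_cong)
  have QP: "?Q * ?P = 1\<^sub>m n"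
    using mat_mult_left_right_inverse[OF _ _ PQ] by simp
  have PA: "?P * A = mat n n (\<lambda>(i, j). A $$ (\<pi> i, j))"
    using A by (intro eq_matI) (auto simp: scalar_prod_def mem if_distrib[of "\<lambda>x. x * _"] cong: if_cong)
  have "?P * A * ?Q = ?B"
    unfolding PA
    by (rule eq_matI) (auto simp: scalar_prod_def mem if_distrib[of "\<lambda>x. _ * x"] cong: if_cong)
  then have "similar_mat_wit ?B A ?P ?Q"
    using PQ QP A by (auto simp: similar_mat_wit_def Let_def)
  then show ?thesis
    by (intro char_poly_similar) (auto simp: similar_mat_def)
qed

lemma char_poly_laplacian_matrix_of:
  assumes G: "pair_graph G" and f: "bij_betw f {..<num_verts G} (pverts G)"
  shows "char_poly (laplacian_matrix_of f G) = char_poly (laplacian_matrix G)"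
proof -
  let ?n = "num_verts G"
  let ?g = "from_nat_into (pverts G)"
  define \<pi> where "\<pi> i = inv_into {..<?n} ?g (f i)" for i
  have g: "bij_betw ?g {..<?n} (pverts G)"
    unfolding num_verts_def by (rule bij_betw_from_nat_into_finite) (rule pair_graphD(1)[OF G])
  have "bij_betw (inv_into {..<?n} ?g \<circ> f) {..<?n} {..<?n}"
    using f bij_betw_inv_into[OF g] by (rule bij_betw_trans)
  then have pi: "bij_betw \<pi> {..<?n} {..<?n}" by (simp add: \<pi>_def[abs_def] comp_def)
  have mem: "\<And>i. i < ?n \<Longrightarrow> \<pi> i < ?n" using pi by (auto simp: bij_betw_def)
  have inj: "\<And>i j. i < ?n \<Longrightarrow> j < ?n \<Longrightarrow> \<pi> i = \<pi> j \<longleftrightarrow> i = j"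
    using pi by (auto simp: bij_betw_def inj_on_def)
  have eq: "\<And>i. i < ?n \<Longrightarrow> ?g (\<pi> i) = f i"
    using f g unfolding \<pi>_def by (auto intro!: bij_betw_inv_into_right dest: bij_betwE)
  have L: "laplacian_matrix G \<in> carrier_mat ?n ?n"
    by (simp add: laplacian_matrix_def laplacian_matrix_of_def adjacency_matrix_of_def
        degree_matrix_of_def minus_mat_def)
  have "laplacian_matrix_of f G = mat ?n ?n (\<lambda>(i, j). laplacian_matrix G $$ (\<pi> i, \<pi> j))"
    by (rule eq_matI) (auto simp: laplacian_matrix_def laplacian_matrix_of_def
        adjacency_matrix_of_def degree_matrix_of_def mem inj eq)
  then show ?thesis by (simp add: char_poly_reindex[OF L pi])
qed

end

theory Submission
  imports Defs "Jordan_Normal_Form.Schur_Decomposition"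
begin

text \<open>
  Write \<open>D\<close> for the double graph, which has \<open>2 n\<close> vertices and \<open>4 m\<close> edges, \<open>a\<close> for the average degree
  of the join, and \<open>\<mu>\<close> for the Laplacian eigenvalues of \<open>D\<close>. By the theorem on the Laplacian spectrum of
  a join (\<open>laplacian_eigenvalues_graph_join\<close>), the Laplacian eigenvalues of the join of \<open>D\<close> with the edgeless
  graph on \<open>p\<close> vertices are \<open>0\<close>, \<open>p + 2 n\<close>, the value \<open>2 n\<close> with multiplicity \<open>p - 1\<close>, and \<open>p + \<mu>\<close> for all
  \<open>\<mu>\<close> except one zero. (For \<open>n = 0\<close> there is no \<open>\<mu>\<close> to leave out; the theorem avoids this case
  distinction by adding the omitted values to the other side.)

  All \<open>\<mu>\<close> are nonnegative, and the hypotheses on \<open>p\<close>, \<open>k\<close> and \<open>m\<close> give \<open>2 n \<le> a \<le> p\<close>. So exactly \<open>0\<close> and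
  the copies of \<open>2 n\<close> may lie below \<open>a\<close>, and the energy is the sum of
  \<open>a\<close>, \<open>p + 2 n - a\<close>, \<open>(p - 1) (a - 2 n)\<close> and all \<open>p + \<mu> - a\<close> except one \<open>p - a\<close>. The eigenvalues \<open>\<mu>\<close> of \<open>D\<close>
  enter only through their number \<open>2 n\<close> and their sum, which is the trace \<open>8 m\<close> of its Laplacian matrix;
  the total is the stated value.

  Two facts of linear algebra carry this. The characteristic polynomial of a real symmetric matrix splits
  over the reals (\<open>char_poly_symmetric_splits\<close>), so its real roots account for all eigenvalues and sum to
  the trace. And a block matrix whose off-diagonal blocks are constant and whose diagonal blocks have
  constant row sums has an explicit determinant (\<open>det_four_block_mat_row_sums\<close>), which yields the
  characteristic polynomial of the Laplacian matrix of a join.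
\<close>

section \<open>Determinants of block matrices with constant row sums\<close>

abbreviation const_mat :: "nat \<Rightarrow> nat \<Rightarrow> 'a \<Rightarrow> 'a mat" where
  "const_mat r c s \<equiv> mat r c (\<lambda>_. s)"

text \<open>
  Block Gaussian elimination. If \<open>A\<close> were invertible, \<open>A\<inverse> * B\<close> would be the factor that clears the
  block \<open>B\<close>. Asking instead for some \<open>X\<close> with \<open>B = A * X\<close> covers singular \<open>A\<close> as well, and for
  matrices with constant row sums such an \<open>X\<close> is known without inverting \<open>A\<close>.
\<close>

lemma det_four_block_mat_schur_upper_left:
  fixes A :: "'a :: idom mat"
  assumes A: "A \<in> carrier_mat n n" and X: "X \<in> carrier_mat n m"
    and C: "C \<in> carrier_mat m n" and D: "D \<in> carrier_mat m m"
  shows "det (four_block_mat A (A * X) C D) = det A * det (D - C * X)"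
proof -
  let ?N = "four_block_mat (1\<^sub>m n) X (0\<^sub>m m n) (1\<^sub>m m)"
  let ?L = "four_block_mat A (0\<^sub>m n m) C (D - C * X)"
  have L: "?L \<in> carrier_mat (n + m) (n + m)" and N: "?N \<in> carrier_mat (n + m) (n + m)"
    using assms by auto
  have "four_block_mat A (A * X) C D = ?L * ?N"
    by (subst mult_four_block_mat[of A n n _ m C m _ _ n _ m]) (use assms in auto)
  moreover have "det ?N = 1"
    by (subst det_four_block_mat_lower_left_zero[of _ n _ m]) (use X in auto)
  moreover have "det ?L = det A * det (D - C * X)"
    by (rule det_four_block_mat_upper_right_zero[of _ n _ m]) (use assms in auto)
  ultimately show ?thesis using det_mult[OF L N] by simp
qed

lemma det_four_block_mat_schur_lower_right:
  fixes A :: "'a :: idom mat"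
  assumes A: "A \<in> carrier_mat n n" and B: "B \<in> carrier_mat n m"
    and Y: "Y \<in> carrier_mat m n" and D: "D \<in> carrier_mat m m"
  shows "det (four_block_mat A B (D * Y) D) = det D * det (A - B * Y)"
proof -
  let ?N = "four_block_mat (1\<^sub>m n) (0\<^sub>m n m) Y (1\<^sub>m m)"
  let ?L = "four_block_mat (A - B * Y) B (0\<^sub>m m n) D"
  have L: "?L \<in> carrier_mat (n + m) (n + m)" and N: "?N \<in> carrier_mat (n + m) (n + m)"
    using assms by auto
  have "four_block_mat A B (D * Y) D = ?L * ?N"
    by (subst mult_four_block_mat[of _ n n _ m _ m _ _ n _ m]) (use assms in auto)
  moreover have "det ?N = 1"
    by (subst det_four_block_mat_upper_right_zero[of _ n _ m]) (use Y in auto)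
  moreover have "det ?L = det (A - B * Y) * det D"
    by (rule det_four_block_mat_lower_left_zero[of _ n _ m]) (use assms in auto)
  ultimately show ?thesis using det_mult[OF L N] by simp
qed

text \<open>
  The constant matrix has rank one, so it factors as a column times a row. Eliminating the bordered
  matrix from its upper left corner gives the determinant of order \<open>n\<close>, eliminating it from its lower
  right corner gives a determinant of order one.
\<close>

lemma det_one_minus_const_mat:
  fixes s :: "'a :: idom"
  shows "det (1\<^sub>m n - const_mat n n s) = 1 - of_nat n * s"
proof -
  let ?u = "const_mat 1 n s" and ?v = "const_mat n 1 (1 :: 'a)"
  have "det (four_block_mat (1\<^sub>m 1) (1\<^sub>m 1 * ?u) ?v (1\<^sub>m n)) = det (1\<^sub>m n - ?v * ?u)"
    by (subst det_four_block_mat_schur_upper_left[of _ 1 _ n]) auto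
  moreover have "det (four_block_mat (1\<^sub>m 1) ?u (1\<^sub>m n * ?v) (1\<^sub>m n)) = det (1\<^sub>m 1 - ?u * ?v)"
    by (subst det_four_block_mat_schur_lower_right[of _ 1 _ n]) auto
  moreover have "1\<^sub>m 1 * ?u = ?u" "1\<^sub>m n * ?v = ?v"
    by auto
  moreover have "?v * ?u = const_mat n n s"
    by (rule eq_matI) (auto simp: scalar_prod_def)
  moreover have "det (1\<^sub>m 1 - ?u * ?v) = 1 - of_nat n * s"
    by (subst det_single) (auto simp: scalar_prod_def)
  ultimately show ?thesis by simp
qed

lemma mult_const_mat:
  fixes A :: "'a :: comm_ring_1 mat"
  assumes "A \<in> carrier_mat n n" and "\<And>i. i < n \<Longrightarrow> (\<Sum>j<n. A $$ (i, j)) = b"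
  shows "A * const_mat n m s = const_mat n m (b * s)"
  by (rule eq_matI)
    (use assms in \<open>auto simp: scalar_prod_def lessThan_atLeast0 simp flip: sum_distrib_right\<close>)

text \<open>
  \<open>A\<close> maps the all-ones vector to \<open>b\<close> times itself, so dividing the all-ones block by \<open>b\<close> solves
  \<open>A * X = J\<close>. Then \<open>D\<close> is only changed by a constant matrix, which is in turn a right multiple of \<open>D\<close>
  because \<open>D\<close> has constant row sums too.
\<close>

lemma det_four_block_mat_row_sums:
  fixes A :: "'a :: field mat"
  assumes A: "A \<in> carrier_mat n n" and rA: "\<And>i. i < n \<Longrightarrow> (\<Sum>j<n. A $$ (i, j)) = b"
    and D: "D \<in> carrier_mat m m" and rD: "\<And>i. i < m \<Longrightarrow> (\<Sum>j<m. D $$ (i, j)) = c"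
    and "b \<noteq> 0" and "c \<noteq> 0"
  shows "b * c * det (four_block_mat A (const_mat n m 1) (const_mat m n 1) D)
    = (b * c - of_nat n * of_nat m) * det A * det D"
proof -
  let ?X = "const_mat n m (1 / b)" and ?J = "const_mat m n (1 :: 'a)"
  have AX: "A * ?X = const_mat n m 1"
    using mult_const_mat[OF A rA] \<open>b \<noteq> 0\<close> by simp
  define s where "s = of_nat n / (b * c)"
  have "D - ?J * ?X = D * (1\<^sub>m m - const_mat m m s)"
  proof -
    have "?J * ?X = const_mat m m (of_nat n / b)"
      by (rule eq_matI) (auto simp: scalar_prod_def)
    also have "\<dots> = D * const_mat m m s"
      using mult_const_mat[OF D rD] \<open>c \<noteq> 0\<close> by (simp add: s_def)
    finally show ?thesis
      using D mult_minus_distrib_mat[OF D one_carrier_mat, of "const_mat m m s"] by simp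
  qed
  then have "det (D - ?J * ?X) = det D * (1 - of_nat m * s)"
    using det_mult[OF D minus_carrier_mat[OF mat_carrier]] by (simp add: det_one_minus_const_mat)
  moreover have "det (four_block_mat A (const_mat n m 1) ?J D) = det A * det (D - ?J * ?X)"
    using det_four_block_mat_schur_upper_left[OF A _ _ D, of ?X ?J] by (simp add: AX)
  ultimately have "det (four_block_mat A (const_mat n m 1) ?J D)
      = det A * (det D * (1 - of_nat m * s))"
    by simp
  then show ?thesis
    using \<open>b \<noteq> 0\<close> \<open>c \<noteq> 0\<close> by (simp add: s_def field_simps)
qed

text \<open>
  The matrix has the shape of the Laplacian of a join. At a point \<open>x\<close>, the diagonal blocks of the
  characteristic matrix have row sums \<open>x - m\<close> and \<open>x - n\<close>, and
  \<open>(x - m) (x - n) - n m = x (x - (n + m))\<close>. The two linear factors on the left stand for the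
  zero eigenvalue of each block, which the join moves to \<open>0\<close> and \<open>n + m\<close>.
\<close>

lemma char_poly_four_block_zero_row_sums:
  fixes A :: "'a :: field_char_0 mat"
  assumes A: "A \<in> carrier_mat n n" and rA: "\<And>i. i < n \<Longrightarrow> (\<Sum>j<n. A $$ (i, j)) = 0"
    and D: "D \<in> carrier_mat m m" and rD: "\<And>i. i < m \<Longrightarrow> (\<Sum>j<m. D $$ (i, j)) = 0"
  shows "[:- of_nat m, 1:] * [:- of_nat n, 1:]
      * char_poly (four_block_mat (A + of_nat m \<cdot>\<^sub>m 1\<^sub>m n) (const_mat n m (- 1))
          (const_mat m n (- 1)) (D + of_nat n \<cdot>\<^sub>m 1\<^sub>m m))
    = [:0, 1:] * [:- of_nat (n + m), 1:]
      * pcompose (char_poly A) [:- of_nat m, 1:] * pcompose (char_poly D) [:- of_nat n, 1:]"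
    (is "?p * ?q * char_poly ?M = ?rhs")
proof -
  \<comment> \<open>The determinant formula divides by both row sums; the polynomials agree on the remaining,
    infinitely many points.\<close>
  let ?S = "- {of_nat m, of_nat n} :: 'a set"
  have eq: "poly (?p * ?q * char_poly ?M) x = poly ?rhs x" if x: "x \<in> ?S" for x
  proof -
    let ?b = "x - of_nat m" and ?c = "x - of_nat n"
    let ?A = "- char_matrix A ?b" and ?D = "- char_matrix D ?c"
    have M: "?M \<in> carrier_mat (n + m) (n + m)" using A D by auto
    have "- char_matrix ?M x = four_block_mat ?A (const_mat n m 1) (const_mat m n 1) ?D"
      by (rule eq_matI) (use A D in \<open>auto simp: char_matrix_def\<close>)
    then have M_x: "poly (char_poly ?M) x = det (four_block_mat ?A (const_mat n m 1) (const_mat m n 1) ?D)"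
      using char_poly_matrix[OF M] by simp
    have "?b * ?c * poly (char_poly ?M) x
        = (?b * ?c - of_nat n * of_nat m) * det ?A * det ?D"
      unfolding M_x
    proof (rule det_four_block_mat_row_sums)
      show "(\<Sum>j<n. ?A $$ (i, j)) = ?b" if i: "i < n" for i
      proof -
        have "(\<Sum>j<n. ?A $$ (i, j)) = (\<Sum>j<n. (if i = j then ?b else 0) - A $$ (i, j))"
          by (rule sum.cong) (use A i in \<open>auto simp: char_matrix_def\<close>)
        then show ?thesis using rA[OF i] i by (simp add: sum_subtractf)
      qed
      show "(\<Sum>j<m. ?D $$ (i, j)) = ?c" if i: "i < m" for i
      proof -
        have "(\<Sum>j<m. ?D $$ (i, j)) = (\<Sum>j<m. (if i = j then ?c else 0) - D $$ (i, j))"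
          by (rule sum.cong) (use D i in \<open>auto simp: char_matrix_def\<close>)
        then show ?thesis using rD[OF i] i by (simp add: sum_subtractf)
      qed
    qed (use A D x in auto)
    also have "?b * ?c - of_nat n * of_nat m = x * (x - of_nat (n + m))"
      by (simp add: algebra_simps)
    finally show ?thesis
      using char_poly_matrix[OF A, of ?b] char_poly_matrix[OF D, of ?c]
      by (simp add: poly_pcompose algebra_simps)
  qed
  have "infinite ?S"
    by (simp add: finite_compl infinite_UNIV_char_0)
  moreover have "?S \<subseteq> {x. poly (?p * ?q * char_poly ?M - ?rhs) x = 0}"
    using eq by auto
  ultimately have "infinite {x. poly (?p * ?q * char_poly ?M - ?rhs) x = 0}"
    using finite_subset by blast
  then show ?thesis
    using poly_roots_finite[of "?p * ?q * char_poly ?M - ?rhs"] by auto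
qed

section \<open>Spectra of real symmetric matrices\<close>

text \<open>
  For an eigenvector \<open>v\<close>, the value \<open>q = v\<^sup>* A v\<close> of the Hermitian form is fixed by conjugation and
  equals \<open>z\<close> times the squared norm of \<open>v\<close>.
\<close>

lemma eigenvalue_symmetric_real:
  fixes A :: "real mat"
  assumes A: "A \<in> carrier_mat n n" and sym: "\<And>i j. i < n \<Longrightarrow> j < n \<Longrightarrow> A $$ (i, j) = A $$ (j, i)"
    and ev: "eigenvalue (map_mat complex_of_real A) z"
  shows "z \<in> \<real>"
proof -
  from ev obtain v where v: "v \<in> carrier_vec n" and v0: "v \<noteq> 0\<^sub>v n"
    and Av: "map_mat complex_of_real A *\<^sub>v v = z \<cdot>\<^sub>v v"
    using A by (auto simp: eigenvalue_def eigenvector_def)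
  have row: "(\<Sum>j<n. of_real (A $$ (i, j)) * v $ j) = z * v $ i" if "i < n" for i
    using arg_cong[OF Av, of "\<lambda>w. w $ i"] A v that
    by (simp add: scalar_prod_def lessThan_atLeast0)
  define q where "q = (\<Sum>i<n. \<Sum>j<n. cnj (v $ i) * (of_real (A $$ (i, j)) * v $ j))"
  define r where "r = (\<Sum>i<n. (cmod (v $ i))\<^sup>2)"
  have "q = (\<Sum>i<n. cnj (v $ i) * (z * v $ i))"
    by (simp add: q_def row flip: sum_distrib_left)
  also have "\<dots> = z * of_real r"
    unfolding r_def of_real_sum complex_norm_square sum_distrib_left by (simp add: mult_ac)
  finally have q: "q = z * of_real r" .
  have "cnj q = (\<Sum>i<n. \<Sum>j<n. cnj (v $ j) * (of_real (A $$ (j, i)) * v $ i))"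
    by (simp add: q_def sym algebra_simps)
  also have "\<dots> = q"
    unfolding q_def by (rule sum.swap)
  finally have "cnj z * of_real r = z * of_real r"
    by (simp add: q)
  moreover have "r \<noteq> 0"
  proof
    assume "r = 0"
    then have "\<forall>i<n. v $ i = 0" by (auto simp: r_def sum_nonneg_eq_0_iff)
    then show False using v v0 by (auto simp: vec_eq_iff)
  qed
  ultimately show ?thesis by (simp add: Reals_cnj_iff)
qed

text \<open>
  The fundamental theorem of algebra splits the polynomial over the complex numbers; all its roots are
  real, and the embedding of the real polynomials is injective.
\<close>

lemma char_poly_symmetric_splits:
  fixes A :: "real mat"
  assumes A: "A \<in> carrier_mat n n" and sym: "\<And>i j. i < n \<Longrightarrow> j < n \<Longrightarrow> A $$ (i, j) = A $$ (j, i)"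
  obtains as where "char_poly A = (\<Prod>a\<leftarrow>as. [:- a, 1:])" and "length as = n"
proof -
  let ?C = "map_mat complex_of_real A"
  have C: "?C \<in> carrier_mat n n" using A by simp
  obtain zs where zs: "char_poly ?C = (\<Prod>z\<leftarrow>zs. [:- z, 1:])" and len: "length zs = n"
    using char_poly_factorized[OF C] by blast
  have real: "z = of_real (Re z)" if "z \<in> set zs" for z
  proof -
    have "poly (char_poly ?C) z = 0"
      using that by (auto simp: zs poly_prod_list prod_list_zero_iff)
    then show ?thesis
      using eigenvalue_symmetric_real[OF A sym] eigenvalue_root_char_poly[OF C] by simp
  qed
  interpret p: map_poly_inj_idom_hom complex_of_real ..
  have "map_poly complex_of_real (char_poly A) = (\<Prod>z\<leftarrow>zs. [:- z, 1:])"
    by (simp add: of_real_hom.char_poly_hom[OF A] flip: zs)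
  also have "\<dots> = map_poly complex_of_real (\<Prod>a\<leftarrow>map Re zs. [:- a, 1:])"
    using real
  proof (induction zs)
    case (Cons z zs)
    have "[:- z, 1:] = map_poly complex_of_real [:- Re z, 1:]"
      using Cons.prems[of z, symmetric] by simp
    then show ?case
      using Cons by (simp add: p.hom_mult del: mult_pCons_left)
  qed simp
  finally have "char_poly A = (\<Prod>a\<leftarrow>map Re zs. [:- a, 1:])"
    by simp
  then show ?thesis using len that[of "map Re zs"] by simp
qed

lemma sum_diag_mult_commute:
  fixes A :: "'a :: comm_ring_1 mat"
  assumes "A \<in> carrier_mat n m" and "B \<in> carrier_mat m n"
  shows "(\<Sum>i<n. (A * B) $$ (i, i)) = (\<Sum>j<m. (B * A) $$ (j, j))"
proof -
  have "(\<Sum>i<n. (A * B) $$ (i, i)) = (\<Sum>i<n. \<Sum>j<m. A $$ (i, j) * B $$ (j, i))"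
    using assms by (intro sum.cong) (auto simp: scalar_prod_def lessThan_atLeast0)
  also have "\<dots> = (\<Sum>j<m. \<Sum>i<n. B $$ (j, i) * A $$ (i, j))"
    by (subst sum.swap) (simp add: mult.commute)
  also have "\<dots> = (\<Sum>j<m. (B * A) $$ (j, j))"
    using assms by (intro sum.cong) (auto simp: scalar_prod_def lessThan_atLeast0)
  finally show ?thesis .
qed

text \<open>
  Schur's theorem gives a similar triangular matrix with the roots on the diagonal, and the trace is
  invariant under similarity.
\<close>

lemma sum_list_roots_eq_trace:
  fixes A :: "'a :: conjugatable_ordered_field mat"
  assumes A: "A \<in> carrier_mat n n" and split: "char_poly A = (\<Prod>a\<leftarrow>as. [:- a, 1:])"
  shows "sum_list as = (\<Sum>i<n. A $$ (i, i))"
proof -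
  obtain B P Q where sd: "schur_decomposition A as = (B, P, Q)"
    by (cases "schur_decomposition A as")
  have wit: "similar_mat_wit A B P Q" and diag: "diag_mat B = as"
    using schur_decomposition[OF A split sd] by auto
  note w = similar_mat_witD2[OF A wit]
  have "(\<Sum>i<n. A $$ (i, i)) = (\<Sum>i<n. (P * (B * Q)) $$ (i, i))"
    using w by (simp add: assoc_mult_mat[of _ n n _ n _ n])
  also have "\<dots> = (\<Sum>i<n. (B * Q * P) $$ (i, i))"
    using w by (intro sum_diag_mult_commute) auto
  also have "B * Q * P = B"
    using w by (simp add: assoc_mult_mat[of _ n n _ n _ n])
  also have "(\<Sum>i<n. B $$ (i, i)) = sum_list (diag_mat B)"
    using w by (simp add: diag_mat_def sum_list_sum_nth lessThan_atLeast0)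
  finally show ?thesis by (simp add: diag)
qed

lemma proots_linear_factors: "proots (\<Prod>a\<leftarrow>as. [:- a, 1 :: 'a :: idom:]) = mset as"
proof (induction as)
  case (Cons a as)
  have "(\<Prod>a\<leftarrow>as. [:- a, 1:]) \<noteq> 0"
    by (auto simp: prod_list_zero_iff)
  then show ?case using Cons by (simp add: proots_mult del: mult_pCons_left)
qed simp

text \<open>
  Gershgorin's argument: in the row of a largest entry of an eigenvector, the off-diagonal terms
  cannot outweigh the diagonal one, so \<open>x\<close> lies within \<open>A $$ (i, i)\<close> of \<open>A $$ (i, i)\<close>.
\<close>

lemma eigenvalue_diagonally_dominant_nonneg:
  fixes A :: "real mat"
  assumes A: "A \<in> carrier_mat n n"
    and dom: "\<And>i. i < n \<Longrightarrow> (\<Sum>j\<in>{..<n} - {i}. \<bar>A $$ (i, j)\<bar>) \<le> A $$ (i, i)"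
    and ev: "eigenvalue A x"
  shows "0 \<le> x"
proof -
  from ev obtain v where v: "v \<in> carrier_vec n" and v0: "v \<noteq> 0\<^sub>v n" and Av: "A *\<^sub>v v = x \<cdot>\<^sub>v v"
    using A by (auto simp: eigenvalue_def eigenvector_def)
  obtain k where k: "k < n" "v $ k \<noteq> 0" using v v0 by (auto simp: vec_eq_iff)
  have ne: "finite {..<n}" "{..<n} \<noteq> {}" using k by auto
  have "Max ((\<lambda>i. \<bar>v $ i\<bar>) ` {..<n}) \<in> (\<lambda>i. \<bar>v $ i\<bar>) ` {..<n}"
    by (rule Max_in) (use ne in auto)
  then obtain i where i: "i < n" and "\<bar>v $ i\<bar> = Max ((\<lambda>i. \<bar>v $ i\<bar>) ` {..<n})"
    by auto
  then have max: "\<bar>v $ j\<bar> \<le> \<bar>v $ i\<bar>" if "j < n" for j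
    using that by simp
  have pos: "0 < \<bar>v $ i\<bar>" using max[OF k(1)] k(2) by linarith
  have "x * v $ i = (\<Sum>j<n. A $$ (i, j) * v $ j)"
    using arg_cong[OF Av, of "\<lambda>w. w $ i"] A v i by (simp add: scalar_prod_def lessThan_atLeast0)
  also have "\<dots> = A $$ (i, i) * v $ i + (\<Sum>j\<in>{..<n} - {i}. A $$ (i, j) * v $ j)"
    using i by (simp add: sum.remove)
  finally have "\<bar>(A $$ (i, i) - x) * v $ i\<bar> = \<bar>\<Sum>j\<in>{..<n} - {i}. A $$ (i, j) * v $ j\<bar>"
    by (simp add: algebra_simps)
  also have "\<dots> \<le> (\<Sum>j\<in>{..<n} - {i}. \<bar>A $$ (i, j)\<bar> * \<bar>v $ i\<bar>)"
    by (rule order.trans[OF sum_abs]) (auto simp: abs_mult intro!: sum_mono mult_left_mono max)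
  also have "\<dots> \<le> A $$ (i, i) * \<bar>v $ i\<bar>"
    using mult_right_mono[OF dom[OF i]] by (simp add: sum_distrib_right)
  finally have "\<bar>A $$ (i, i) - x\<bar> \<le> A $$ (i, i)"
    using pos by (simp add: abs_mult)
  then show ?thesis by linarith
qed

section \<open>Degrees and the Laplacian matrix\<close>

lemma vertex_degree_eq_card_neighbours: "vertex_degree G v = card {w. (v, w) \<in> parcs G}"
proof -
  have "out_arcs (with_proj G) v = Pair v ` {w. (v, w) \<in> parcs G}"
    by (auto simp: out_arcs_def)
  then show ?thesis
    by (simp add: vertex_degree_def out_degree_def card_image inj_on_def)
qed

text \<open>
  The handshake lemma: counting arcs by their tails gives the degree sum, counting them by their
  underlying edges gives two for each edge.
\<close>

lemma sum_vertex_degree: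
  assumes G: "pair_graph G"
  shows "(\<Sum>v\<in>pverts G. vertex_degree G v) = 2 * num_edges G"
proof -
  interpret pair_graph G by fact
  let ?e = "\<lambda>(u, v). {u, v}"
  have "(\<Sum>v\<in>pverts G. vertex_degree G v) = (\<Sum>v\<in>pverts G. \<Sum>a\<in>{a \<in> parcs G. fst a = v}. 1)"
    by (simp add: vertex_degree_def out_degree_def out_arcs_def)
  also have "\<dots> = (\<Sum>a\<in>parcs G. 1)"
    using pair_graphD(1)[OF G] by (rule sum.group[rotated]) (auto dest: pair_graphD(2)[OF G])
  also have "\<dots> = (\<Sum>e\<in>edge_set G. \<Sum>a\<in>{a \<in> parcs G. ?e a = e}. 1)"
    by (rule sum.group[symmetric]) (auto simp: edge_set_def)
  also have "\<dots> = (\<Sum>e\<in>edge_set G. 2)"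
  proof (rule sum.cong[OF refl])
    fix e assume "e \<in> edge_set G"
    then obtain u v where e: "e = {u, v}" and uv: "(u, v) \<in> parcs G"
      by (auto simp: edge_set_def)
    have "{a \<in> parcs G. ?e a = e} = {(u, v), (v, u)}"
      using uv pair_graphD(2)[OF G uv] by (auto simp: e doubleton_eq_iff)
    then show "(\<Sum>a\<in>{a \<in> parcs G. ?e a = e}. 1) = (2 :: nat)"
      using pair_graphD(2)[OF G uv] by simp
  qed
  finally show ?thesis by (simp add: num_edges_def)
qed

lemma bij_betw_vertex_enumeration:
  "pair_graph G \<Longrightarrow> bij_betw (from_nat_into (pverts G)) {..<num_verts G} (pverts G)"
  unfolding num_verts_def by (rule bij_betw_from_nat_into_finite) (rule pair_graphD(1))

lemma laplacian_matrix_of_carrier [simp]: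
  "laplacian_matrix_of f G \<in> carrier_mat (num_verts G) (num_verts G)"
  by (simp add: laplacian_matrix_of_def adjacency_matrix_of_def degree_matrix_of_def minus_mat_def)

lemma laplacian_matrix_of_index:
  assumes "i < num_verts G" and "j < num_verts G"
  shows "laplacian_matrix_of f G $$ (i, j)
    = (if i = j then real (vertex_degree G (f i)) else 0) - (if (f i, f j) \<in> parcs G then 1 else 0)"
  using assms by (auto simp: laplacian_matrix_of_def adjacency_matrix_of_def degree_matrix_of_def)

lemma laplacian_matrix_of_symmetric:
  assumes "pair_graph G" and "i < num_verts G" and "j < num_verts G"
  shows "laplacian_matrix_of f G $$ (i, j) = laplacian_matrix_of f G $$ (j, i)"
  using assms by (auto simp: laplacian_matrix_of_index dest: pair_graphD(2))

lemma laplacian_matrix_of_row_sum: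
  assumes G: "pair_graph G" and f: "bij_betw f {..<num_verts G} (pverts G)" and i: "i < num_verts G"
  shows "(\<Sum>j<num_verts G. laplacian_matrix_of f G $$ (i, j)) = 0"
proof -
  have "(\<Sum>j<num_verts G. if (f i, f j) \<in> parcs G then 1 else 0)
      = (\<Sum>w\<in>pverts G. if (f i, w) \<in> parcs G then 1 else (0 :: real))"
    by (rule sum.reindex_bij_betw[OF f])
  also have "\<dots> = real (card (pverts G \<inter> {w. (f i, w) \<in> parcs G}))"
    using pair_graphD(1)[OF G] by (simp add: sum.If_cases)
  also have "pverts G \<inter> {w. (f i, w) \<in> parcs G} = {w. (f i, w) \<in> parcs G}"
    using pair_graphD(2)[OF G] by auto
  finally show ?thesis
    using i by (simp add: laplacian_matrix_of_index sum_subtractf vertex_degree_eq_card_neighbours)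
qed

lemma laplacian_matrix_of_trace:
  assumes G: "pair_graph G" and f: "bij_betw f {..<num_verts G} (pverts G)"
  shows "(\<Sum>i<num_verts G. laplacian_matrix_of f G $$ (i, i)) = 2 * real (num_edges G)"
proof -
  have "(\<Sum>i<num_verts G. laplacian_matrix_of f G $$ (i, i))
      = (\<Sum>i<num_verts G. real (vertex_degree G (f i)))"
    using pair_graphD(2)[OF G] by (intro sum.cong) (auto simp: laplacian_matrix_of_index)
  also have "\<dots> = real (\<Sum>v\<in>pverts G. vertex_degree G v)"
    using sum.reindex_bij_betw[OF f, of "\<lambda>v. real (vertex_degree G v)"] by simp
  finally show ?thesis by (simp add: sum_vertex_degree[OF G])
qed

lemma laplacian_eigenvalues_list:
  assumes "pair_graph G"
  obtains as where "char_poly (laplacian_matrix G) = (\<Prod>a\<leftarrow>as. [:- a, 1:])"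
    and "laplacian_eigenvalues G = mset as"
  using char_poly_symmetric_splits[OF laplacian_matrix_of_carrier laplacian_matrix_of_symmetric[OF assms]]
  unfolding laplacian_eigenvalues_def laplacian_matrix_def by (metis proots_linear_factors)

lemma size_laplacian_eigenvalues:
  assumes "pair_graph G"
  shows "size (laplacian_eigenvalues G) = num_verts G"
  using char_poly_symmetric_splits[OF laplacian_matrix_of_carrier laplacian_matrix_of_symmetric[OF assms]]
  unfolding laplacian_eigenvalues_def laplacian_matrix_def by (metis proots_linear_factors size_mset)

lemma sum_laplacian_eigenvalues:
  assumes G: "pair_graph G"
  shows "sum_mset (laplacian_eigenvalues G) = 2 * real (num_edges G)"
proof -
  obtain as where as: "char_poly (laplacian_matrix G) = (\<Prod>a\<leftarrow>as. [:- a, 1:])"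
    and eig: "laplacian_eigenvalues G = mset as"
    by (rule laplacian_eigenvalues_list[OF G])
  show ?thesis
    using sum_list_roots_eq_trace[OF laplacian_matrix_of_carrier as[unfolded laplacian_matrix_def]]
      laplacian_matrix_of_trace[OF G bij_betw_vertex_enumeration[OF G]]
    by (simp add: eig sum_mset_sum_list)
qed

text \<open>
  As the row sums vanish and the off-diagonal entries are not positive, the Laplacian matrix is
  diagonally dominant.
\<close>

lemma laplacian_eigenvalues_nonneg:
  assumes G: "pair_graph G" and \<nu>: "\<nu> \<in># laplacian_eigenvalues G"
  shows "0 \<le> \<nu>"
proof (rule eigenvalue_diagonally_dominant_nonneg)
  let ?n = "num_verts G" and ?f = "from_nat_into (pverts G)"
  let ?L = "laplacian_matrix_of ?f G"
  show L: "?L \<in> carrier_mat ?n ?n" by simp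
  have "char_poly ?L \<noteq> 0"
    using degree_monic_char_poly[OF L] by auto
  then show "eigenvalue ?L \<nu>"
    using \<nu> by (simp add: eigenvalue_root_char_poly[OF L] laplacian_eigenvalues_def laplacian_matrix_def)
  show "(\<Sum>j\<in>{..<?n} - {i}. \<bar>?L $$ (i, j)\<bar>) \<le> ?L $$ (i, i)" if i: "i < ?n" for i
  proof -
    have "(\<Sum>j\<in>{..<?n} - {i}. \<bar>?L $$ (i, j)\<bar>) = - (\<Sum>j\<in>{..<?n} - {i}. ?L $$ (i, j))"
      unfolding sum_negf[symmetric]
      by (rule sum.cong) (use i in \<open>auto simp: laplacian_matrix_of_index\<close>)
    also have "\<dots> = ?L $$ (i, i)"
      using laplacian_matrix_of_row_sum[OF G bij_betw_vertex_enumeration[OF G] i] i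
      by (simp add: sum.remove[of _ i])
    finally show ?thesis by simp
  qed
qed

section \<open>The Laplacian spectrum of a join\<close>

lemma parcs_graph_join:
  "(Inl u, Inl u') \<in> parcs (graph_join G H) \<longleftrightarrow> (u, u') \<in> parcs G"
  "(Inr v, Inr v') \<in> parcs (graph_join G H) \<longleftrightarrow> (v, v') \<in> parcs H"
  "(Inl u, Inr v) \<in> parcs (graph_join G H) \<longleftrightarrow> u \<in> pverts G \<and> v \<in> pverts H"
  "(Inr v, Inl u) \<in> parcs (graph_join G H) \<longleftrightarrow> u \<in> pverts G \<and> v \<in> pverts H"
  by (auto simp: graph_join_def)

lemma num_verts_graph_join:
  assumes "pair_graph G" and "pair_graph H"
  shows "num_verts (graph_join G H) = num_verts G + num_verts H"
  using assms[THEN pair_graphD(1)]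
  by (simp add: num_verts_def graph_join_def card_Plus[unfolded Plus_def])

lemma vertex_degree_graph_join_Inl:
  assumes G: "pair_graph G" and H: "pair_graph H" and u: "u \<in> pverts G"
  shows "vertex_degree (graph_join G H) (Inl u) = vertex_degree G u + num_verts H"
proof -
  have "{w. (Inl u, w) \<in> parcs (graph_join G H)} = Inl ` {w. (u, w) \<in> parcs G} \<union> Inr ` pverts H"
    using u by (auto simp: graph_join_def)
  moreover have "finite {w. (u, w) \<in> parcs G}"
    by (rule finite_subset[OF _ pair_graphD(1)[OF G]]) (auto dest: pair_graphD(2)[OF G])
  ultimately show ?thesis
    using pair_graphD(1)[OF H]
    by (simp add: vertex_degree_eq_card_neighbours num_verts_def card_Plus[unfolded Plus_def])
qed

lemma vertex_degree_graph_join_Inr: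
  assumes G: "pair_graph G" and H: "pair_graph H" and v: "v \<in> pverts H"
  shows "vertex_degree (graph_join G H) (Inr v) = vertex_degree H v + num_verts G"
proof -
  have "{w. (Inr v, w) \<in> parcs (graph_join G H)} = Inr ` {w. (v, w) \<in> parcs H} \<union> Inl ` pverts G"
    using v by (auto simp: graph_join_def)
  moreover have "finite {w. (v, w) \<in> parcs H}"
    by (rule finite_subset[OF _ pair_graphD(1)[OF H]]) (auto dest: pair_graphD(2)[OF H])
  ultimately show ?thesis
    using pair_graphD(1)[OF G]
    by (simp add: vertex_degree_eq_card_neighbours num_verts_def Un_commute card_Plus[unfolded Plus_def])
qed

lemma num_edges_graph_join:
  assumes G: "pair_graph G" and H: "pair_graph H"
  shows "num_edges (graph_join G H) = num_edges G + num_edges H + num_verts G * num_verts H"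
proof -
  have "2 * num_edges (graph_join G H)
      = (\<Sum>v\<in>pverts (graph_join G H). vertex_degree (graph_join G H) v)"
    by (rule sum_vertex_degree[symmetric]) (rule pair_graph_graph_join[OF G H])
  also have "pverts (graph_join G H) = Inl ` pverts G \<union> Inr ` pverts H"
    by (simp add: graph_join_def)
  also have "(\<Sum>v\<in>Inl ` pverts G \<union> Inr ` pverts H. vertex_degree (graph_join G H) v)
      = (\<Sum>u\<in>pverts G. vertex_degree G u + num_verts H) + (\<Sum>v\<in>pverts H. vertex_degree H v + num_verts G)"
    using pair_graphD(1)[OF G] pair_graphD(1)[OF H]
    by (subst sum.union_disjoint)
      (auto simp: sum.reindex vertex_degree_graph_join_Inl[OF G H] vertex_degree_graph_join_Inr[OF G H])
  also have "\<dots> = 2 * (num_edges G + num_edges H + num_verts G * num_verts H)"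
    by (simp add: sum.distrib sum_vertex_degree G H flip: num_verts_def)
  finally show ?thesis by simp
qed

text \<open>
  Enumerating \<open>G\<close> before \<open>H\<close> puts the Laplacian matrix of the join into block form: joining raises
  every degree on one side by the order of the other side, and the off-diagonal blocks are constantly
  \<open>- 1\<close>.
\<close>

lemma char_poly_laplacian_graph_join:
  fixes G :: "'a pair_pre_digraph" and H :: "'b pair_pre_digraph"
  assumes G: "pair_graph G" and H: "pair_graph H"
  defines "n \<equiv> num_verts G" and "m \<equiv> num_verts H"
  shows "[:- real m, 1:] * [:- real n, 1:] * char_poly (laplacian_matrix (graph_join G H))
    = [:0, 1:] * [:- real (n + m), 1:]
      * pcompose (char_poly (laplacian_matrix G)) [:- real m, 1:]
      * pcompose (char_poly (laplacian_matrix H)) [:- real n, 1:]"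
proof -
  let ?g = "from_nat_into (pverts G)" and ?h = "from_nat_into (pverts H)"
  let ?J = "graph_join G H"
  define f where "f i = (if i < n then Inl (?g i) else Inr (?h (i - n)))" for i
  note g = bij_betw_vertex_enumeration[OF G, folded n_def]
  note h = bij_betw_vertex_enumeration[OF H, folded m_def]
  have gi: "?g i \<in> pverts G" if "i < n" for i
    using bij_betwE[OF g] that by auto
  have hi: "?h i \<in> pverts H" if "i < m" for i
    using bij_betwE[OF h] that by auto
  have g_inj: "?g i = ?g j \<longleftrightarrow> i = j" if "i < n" "j < n" for i j
    using bij_betw_imp_inj_on[OF g] that by (auto simp: inj_on_def)
  have J: "num_verts ?J = n + m"
    by (simp add: num_verts_graph_join[OF G H] n_def m_def)
  have "f ` {..<n + m} = pverts ?J"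
  proof -
    have "{..<n + m} = {..<n} \<union> (\<lambda>i. i + n) ` {..<m}"
    proof (intro equalityI subsetI)
      show "i \<in> {..<n} \<union> (\<lambda>i. i + n) ` {..<m}" if "i \<in> {..<n + m}" for i
        using that by (cases "i < n") (auto intro!: image_eqI[of _ _ "i - n"])
    qed auto
    moreover have "f ` {..<n} = Inl ` (?g ` {..<n})" "f ` (\<lambda>i. i + n) ` {..<m} = Inr ` (?h ` {..<m})"
      unfolding image_image by (auto simp: f_def)
    ultimately show ?thesis
      by (simp add: image_Un bij_betw_imp_surj_on[OF g] bij_betw_imp_surj_on[OF h] graph_join_def)
  qed
  moreover from this have "inj_on f {..<n + m}"
    using J by (intro eq_card_imp_inj_on) (simp_all add: num_verts_def)
  ultimately have f: "bij_betw f {..<num_verts ?J} (pverts ?J)"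
    by (simp add: bij_betw_def J)
  have "laplacian_matrix_of f ?J
      = four_block_mat (laplacian_matrix G + real m \<cdot>\<^sub>m 1\<^sub>m n) (const_mat n m (- 1))
          (const_mat m n (- 1)) (laplacian_matrix H + real n \<cdot>\<^sub>m 1\<^sub>m m)"
    (is "?L = ?B")
  proof (rule eq_matI)
    have dim: "laplacian_matrix G \<in> carrier_mat n n" "laplacian_matrix H \<in> carrier_mat m m"
      "?L \<in> carrier_mat (n + m) (n + m)"
      using laplacian_matrix_of_carrier[of f ?J] by (simp_all add: laplacian_matrix_def n_def m_def J)
    then show "dim_row ?L = dim_row ?B" "dim_col ?L = dim_col ?B"
      by auto
    fix i j assume "i < dim_row ?B" "j < dim_col ?B"
    then have ij: "i < n + m" "j < n + m" using dim by auto
    have "?L $$ (i, j) = (if i = j then real (vertex_degree ?J (f i)) else 0)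
        - (if (f i, f j) \<in> parcs ?J then 1 else 0)"
      using ij by (intro laplacian_matrix_of_index) (simp_all add: J)
    also have "\<dots> = ?B $$ (i, j)"
      using ij dim gi hi
      by (auto simp: f_def laplacian_matrix_def laplacian_matrix_of_index
          vertex_degree_graph_join_Inl[OF G H] vertex_degree_graph_join_Inr[OF G H]
          parcs_graph_join simp flip: n_def m_def)
    finally show "?L $$ (i, j) = ?B $$ (i, j)" .
  qed
  then have "char_poly (laplacian_matrix ?J) = char_poly ?B"
    using char_poly_laplacian_matrix_of[OF pair_graph_graph_join[OF G H] f] by simp
  moreover have "[:- real m, 1:] * [:- real n, 1:] * char_poly ?B
    = [:0, 1:] * [:- real (n + m), 1:]
      * pcompose (char_poly (laplacian_matrix G)) [:- real m, 1:]
      * pcompose (char_poly (laplacian_matrix H)) [:- real n, 1:]"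
    using laplacian_matrix_of_row_sum[OF G] laplacian_matrix_of_row_sum[OF H] g h
    by (intro char_poly_four_block_zero_row_sums) (auto simp: laplacian_matrix_def n_def m_def)
  ultimately show ?thesis by simp
qed

lemma pcompose_linear_factors:
  "pcompose (\<Prod>a\<leftarrow>as. [:- a, 1 :: 'a :: idom:]) [:- c, 1:] = (\<Prod>a\<leftarrow>map (\<lambda>a. a + c) as. [:- a, 1:])"
proof (induction as)
  case (Cons a as)
  have "pcompose [:- a, 1:] [:- c, 1:] = [:- (a + c), 1:]"
    by (simp add: pcompose_pCons)
  then show ?case using Cons by (simp add: pcompose_mult del: mult_pCons_left)
qed simp

text \<open>
  One zero eigenvalue of each graph becomes \<open>0\<close> and \<open>n + m\<close>, and every other eigenvalue is shifted by
  the order of the other graph. Adding the two shifted zeros on the left expresses this without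
  subtraction of multisets, and remains true when a graph is empty and has no eigenvalue to remove.
\<close>

theorem laplacian_eigenvalues_graph_join:
  assumes G: "pair_graph G" and H: "pair_graph H"
  defines "n \<equiv> num_verts G" and "m \<equiv> num_verts H"
  shows "laplacian_eigenvalues (graph_join G H) + {#real m, real n#}
    = {#0, real (n + m)#} + image_mset (\<lambda>\<nu>. \<nu> + real m) (laplacian_eigenvalues G)
      + image_mset (\<lambda>\<nu>. \<nu> + real n) (laplacian_eigenvalues H)"
proof -
  obtain as where as: "char_poly (laplacian_matrix G) = (\<Prod>a\<leftarrow>as. [:- a, 1:])"
    "laplacian_eigenvalues G = mset as"
    by (rule laplacian_eigenvalues_list[OF G])
  obtain bs where bs: "char_poly (laplacian_matrix H) = (\<Prod>a\<leftarrow>bs. [:- a, 1:])"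
    "laplacian_eigenvalues H = mset bs"
    by (rule laplacian_eigenvalues_list[OF H])
  obtain cs where cs: "char_poly (laplacian_matrix (graph_join G H)) = (\<Prod>a\<leftarrow>cs. [:- a, 1:])"
    "laplacian_eigenvalues (graph_join G H) = mset cs"
    by (rule laplacian_eigenvalues_list[OF pair_graph_graph_join[OF G H]])
  let ?ls = "real m # real n # cs"
  let ?rs = "0 # real (n + m) # map (\<lambda>a. a + real m) as @ map (\<lambda>a. a + real n) bs"
  have "(\<Prod>a\<leftarrow>?ls. [:- a, 1:]) = (\<Prod>a\<leftarrow>?rs. [:- a, 1:])"
    using char_poly_laplacian_graph_join[OF G H, folded n_def m_def]
    unfolding as bs cs pcompose_linear_factors
    by (simp add: mult.assoc del: mult_pCons_left mult_pCons_right of_nat_add)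
  then have "mset ?ls = mset ?rs"
    by (metis proots_linear_factors)
  then show ?thesis by (simp add: as bs cs)
qed

section \<open>Double graphs and edgeless graphs\<close>

lemma num_verts_double_graph: "num_verts (double_graph G) = 2 * num_verts G"
  by (simp add: num_verts_def double_graph_def card_cartesian_product)

lemma vertex_degree_double_graph:
  assumes "a \<in> {1, 2}"
  shows "vertex_degree (double_graph G) (u, a) = 2 * vertex_degree G u"
proof -
  have "{w. ((u, a), w) \<in> parcs (double_graph G)} = {w. (u, w) \<in> parcs G} \<times> {1, 2}"
    using assms by (auto simp: double_graph_def)
  then show ?thesis
    by (simp add: vertex_degree_eq_card_neighbours card_cartesian_product)
qed

lemma num_edges_double_graph:
  assumes G: "pair_graph G"
  shows "num_edges (double_graph G) = 4 * num_edges G"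
proof -
  have "2 * num_edges (double_graph G) = (\<Sum>w\<in>pverts G \<times> {1, 2}. vertex_degree (double_graph G) w)"
    using sum_vertex_degree[OF pair_graph_double_graph[OF G]] by (simp add: double_graph_def)
  also have "\<dots> = (\<Sum>u\<in>pverts G. \<Sum>a\<in>{1, 2 :: nat}. vertex_degree (double_graph G) (u, a))"
    unfolding sum.cartesian_product by simp
  also have "\<dots> = 4 * (\<Sum>u\<in>pverts G. vertex_degree G u)"
    by (simp add: vertex_degree_double_graph sum_distrib_left)
  finally show ?thesis by (simp add: sum_vertex_degree[OF G])
qed

lemma num_verts_edgeless_graph: "num_verts (edgeless_graph p) = p"
  by (simp add: num_verts_def edgeless_graph_def)

lemma num_edges_edgeless_graph: "num_edges (edgeless_graph p) = 0"
  by (simp add: num_edges_def edge_set_def edgeless_graph_def)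

lemma laplacian_eigenvalues_edgeless_graph:
  "laplacian_eigenvalues (edgeless_graph p) = replicate_mset p 0"
proof -
  have no_arcs: "parcs (edgeless_graph p) = {}"
    by (simp add: edgeless_graph_def)
  have "laplacian_matrix (edgeless_graph p) = 0\<^sub>m p p"
    by (rule eq_matI)
      (simp_all add: laplacian_matrix_def laplacian_matrix_of_def adjacency_matrix_of_def
        degree_matrix_of_def num_verts_edgeless_graph vertex_degree_eq_card_neighbours no_arcs)
  moreover have "char_poly (0\<^sub>m p p :: real mat) = (\<Prod>a\<leftarrow>diag_mat (0\<^sub>m p p). [:- a, 1:])"
    by (rule char_poly_upper_triangular) auto
  moreover have "diag_mat (0\<^sub>m p p :: real mat) = replicate p 0"
    by (auto simp: diag_mat_def intro!: nth_equalityI)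
  ultimately show ?thesis
    using proots_linear_factors[of "replicate p (0 :: real)"] by (simp add: laplacian_eigenvalues_def)
qed

section \<open>The Laplacian energy\<close>

theorem theorem4p6:
  fixes G :: "'a pair_pre_digraph"
    and H :: "('a \<times> nat + nat) pair_pre_digraph"
    and n m p k n' m' :: nat
  assumes "pair_graph G"
    and "n = num_verts G" and "m = num_edges G"
    and "k \<ge> 4" and "p \<ge> 2 * n + k"
    and "real m \<le> real k * (2 * real n + real k) / 8"
    and "H = graph_join (double_graph G) (edgeless_graph p)"
    and "n' = num_verts H" and "m' = num_edges H"
  shows "laplacian_energy H
           = 4 * real n + (real p - 2 * real n) * (2 * real m' / real n') + 8 * real m
         \<and> 2 * real m' / real n' = (8 * real m + 4 * real p * real n) / (real p + 2 * real n)
         \<and> average_degree H = 2 * real m' / real n'"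
proof -
  let ?D = "double_graph G" and ?E = "edgeless_graph p"
  have D: "pair_graph ?D" and E: "pair_graph ?E" and pgH: "pair_graph H"
    using assms by (simp_all add: pair_graph_double_graph pair_graph_edgeless_graph pair_graph_graph_join)
  have vD: "num_verts ?D = 2 * n" and eD: "num_edges ?D = 4 * m"
    using assms by (simp_all add: num_verts_double_graph num_edges_double_graph)
  have n': "n' = p + 2 * n" and m': "m' = 4 * m + 2 * p * n"
    using assms vD eD
    by (simp_all add: num_verts_graph_join[OF D E] num_edges_graph_join[OF D E]
        num_verts_edgeless_graph num_edges_edgeless_graph)
  define a where "a = 2 * real m' / real n'"
  have a: "a = (8 * real m + 4 * real p * real n) / (real p + 2 * real n)"
    by (simp add: a_def n' m')
  have p: "real p \<ge> 2 * real n + real k" "real k \<ge> 4"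
    using assms(4,5) by linarith+
  then have pos: "real p + 2 * real n > 0" by linarith
  have a_mult: "a * (real p + 2 * real n) = 8 * real m + 4 * real p * real n"
    using pos by (simp add: a)
  \<comment> \<open>This is the condition for \<open>a \<le> p\<close>; it is where the bound on \<open>m\<close> enters.\<close>
  have "8 * real m \<le> (real p - 2 * real n) * real p"
  proof -
    have "8 * real m \<le> real k * (2 * real n + real k)" using assms(6) by simp
    also have "\<dots> \<le> (real p - 2 * real n) * real p"
      using p by (intro mult_mono) auto
    finally show ?thesis .
  qed
  then have a_le: "a \<le> real p"
    using pos by (simp add: a pos_divide_le_eq algebra_simps)
  have "2 * real n * (2 * real n) \<le> 2 * real n * real p"
    using p by (intro mult_left_mono) auto
  then have a_ge: "2 * real n \<le> a"
    using pos by (simp add: a pos_le_divide_eq algebra_simps)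
  \<comment> \<open>Since \<open>2 n \<le> a \<le> p\<close>, the sign of \<open>\<nu> - a\<close> is known for every eigenvalue \<open>\<nu>\<close>, and the
    absolute values can be summed up using only the number and the sum of the eigenvalues of
    the double graph.\<close>
  let ?f = "\<lambda>\<nu>. \<bar>\<nu> - a\<bar>"
  have energy: "laplacian_energy H = (\<Sum>\<nu>\<in>#laplacian_eigenvalues H. ?f \<nu>)"
    by (simp add: laplacian_energy_def a_def assms(8,9))
  have "(\<Sum>\<nu>\<in>#laplacian_eigenvalues H + {#real p, real (2 * n)#}. ?f \<nu>)
      = (\<Sum>\<nu>\<in>#{#0, real (2 * n + p)#} + image_mset (\<lambda>\<nu>. \<nu> + real p) (laplacian_eigenvalues ?D)
          + image_mset (\<lambda>\<nu>. \<nu> + real (2 * n)) (laplacian_eigenvalues ?E). ?f \<nu>)"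
    using laplacian_eigenvalues_graph_join[OF D E]
    by (simp only: assms(7) vD num_verts_edgeless_graph)
  also have "\<dots> = a + (2 * real n + real p - a) + (\<Sum>\<nu>\<in>#laplacian_eigenvalues ?D. ?f (\<nu> + real p))
      + real p * (a - 2 * real n)"
    using a_le a_ge
    by (simp add: image_mset.compositionality comp_def laplacian_eigenvalues_edgeless_graph)
  also have "(\<Sum>\<nu>\<in>#laplacian_eigenvalues ?D. ?f (\<nu> + real p))
      = (\<Sum>\<nu>\<in>#laplacian_eigenvalues ?D. \<nu> + (real p - a))"
    using laplacian_eigenvalues_nonneg[OF D] a_le
    by (intro arg_cong[of _ _ sum_mset] image_mset_cong) force
  also have "\<dots> = 8 * real m + 2 * real n * (real p - a)"
    using sum_laplacian_eigenvalues[OF D] size_laplacian_eigenvalues[OF D]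
    by (simp add: sum_mset.distrib vD eD)
  finally have "laplacian_energy H = 4 * real n + (real p - 2 * real n) * a + 8 * real m"
    using a_le a_ge a_mult energy by (simp add: algebra_simps)
  moreover have "average_degree H = a"
    using sum_vertex_degree[OF pgH] assms(8,9)
    by (simp add: average_degree_def a_def flip: of_nat_sum)
  ultimately show ?thesis
    using a a_def by simp
qed

end
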